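(* Let $\mathcal{T}=(t_{ijkl})$ be a real 4th-order 3-dimensional cyclic symmetric tensor. Suppose $|t_{1112}|=|t_{1222}|=t_{1122}=t_{1111}=1$ and $t_{1123}=-\frac{7}{12}$. Then $\mathcal{T}$ is positive semi-definite if and only if $t_{1112}t_{1222}=-1$.
   Context: A 4th-order 3-dimensional real tensor $\mathcal{T}=(t_{ijkl})_{1\le i,j,k,l\le 3}$ is symmetric if its entries are invariant under all permutations of the indices. It is cyclic symmetric if it is symmetric and $t_{1111}=t_{2222}=t_{3333}$, $t_{1112}=t_{2223}=t_{1333}$, $t_{1113}=t_{1222}=t_{2333}$, $t_{1122}=t_{1133}=t_{2233}$, $t_{1123}=t_{1223}=t_{1233}$. For $x\in\mathbb{R}^3$, $\mathcal{T}x^4=\sum_{i,j,k,l=1}^3 t_{ijkl}x_ix_jx_kx_l$. $\mathcal{T}$ is positive semi-definite if $\mathcal{T}x^4\ge 0$ for all $x\in\mathbb{R}^3$. *)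

theory Defs
  imports "HOL-Analysis.Analysis"
begin

text \<open>
  A 4th-order tensor with entries in the reals is the array of its entries, with indices in a
  finite type. The index set {1, 2, 3} is the type \<^typ>\<open>3\<close>, whose elements are the numerals
  1, 2, 3 (and 3 = 0 there).
\<close>

type_synonym 'n tensor4 = "'n \<Rightarrow> 'n \<Rightarrow> 'n \<Rightarrow> 'n \<Rightarrow> real"

definition symmetric_tensor :: "'n tensor4 \<Rightarrow> bool" where
  "symmetric_tensor T \<longleftrightarrow>
     (\<forall>\<sigma> (i :: nat \<Rightarrow> 'n). \<sigma> permutes {1..4} \<longrightarrow>
        T (i (\<sigma> 1)) (i (\<sigma> 2)) (i (\<sigma> 3)) (i (\<sigma> 4)) = T (i 1) (i 2) (i 3) (i 4))"

definition cyclic_symmetric :: "3 tensor4 \<Rightarrow> bool" where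
  "cyclic_symmetric T \<longleftrightarrow>
     symmetric_tensor T \<and>
     T 1 1 1 1 = T 2 2 2 2 \<and> T 2 2 2 2 = T 3 3 3 3 \<and>
     T 1 1 1 2 = T 2 2 2 3 \<and> T 2 2 2 3 = T 1 3 3 3 \<and>
     T 1 1 1 3 = T 1 2 2 2 \<and> T 1 2 2 2 = T 2 3 3 3 \<and>
     T 1 1 2 2 = T 1 1 3 3 \<and> T 1 1 3 3 = T 2 2 3 3 \<and>
     T 1 1 2 3 = T 1 2 2 3 \<and> T 1 2 2 3 = T 1 2 3 3"

definition tensor_form :: "'n::finite tensor4 \<Rightarrow> real ^ 'n \<Rightarrow> real" where
  "tensor_form T x =
     (\<Sum>i\<in>UNIV. \<Sum>j\<in>UNIV. \<Sum>k\<in>UNIV. \<Sum>l\<in>UNIV. T i j k l * x $ i * x $ j * x $ k * x $ l)"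

definition positive_semidefinite :: "'n::finite tensor4 \<Rightarrow> bool" where
  "positive_semidefinite T \<longleftrightarrow> (\<forall>x. tensor_form T x \<ge> 0)"

end

theory Submission
  imports Defs
begin

text \<open>
  Put a = \<open>T 1 1 1 2\<close> and b = \<open>T 1 2 2 2\<close>, both of them 1 or -1, and write x, y, z for the
  coordinates. By cyclic symmetry the quartic form is
  \[
    \sum x^4 + 4a (x^3 y + y^3 z + z^3 x) + 4b (x^3 z + y^3 x + z^3 y)
      + 6 \sum x^2 y^2 - 7xyz(x + y + z)
  \]
  (lemma \<open>tensor_form_cyclic_symmetric\<close>).

  If a = b, one point shows that the form takes a negative value. For a = b = 1 it equals
  s^4 - 19xyzs with s = x + y + z, which is negative where s is small and xyzs is positive, for
  instance at (20, -10, -9). For a = b = -1 it is negative at (1, 1, 1).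

  If b = -a, the form vanishes at (1, 1, 1), which leaves little room for a sum of squares: every
  square in it must vanish there as well. The cyclic group of order 3 acts on the quadratic forms
  vanishing at (1, 1, 1), and the parts where it acts without fixed vectors are spanned by
  differences of x^2, y^2, z^2 and differences of xy, yz, zx. These two families suffice. The
  terms with coefficient 4a add up to 4a (xy A + yz B + zx C), where
  A = x^2 - y^2, B = y^2 - z^2, C = z^2 - x^2. Since A + B + C = 0, the products xy, yz, zx may be
  replaced here by their deviations from their mean, and completing the squares
  leaves a nonnegative multiple of the sum of squared differences of xy, yz, zx
  (lemma \<open>quartic_nonneg_opposite_signs\<close>).
\<close>

lemma symmetric_tensor_swaps:
  assumes "symmetric_tensor T"
  shows "T j i k l = T i j k l" and "T i k j l = T i j k l" and "T i j l k = T i j k l"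
proof -
  let ?f = "\<lambda>n::nat. if n = 1 then i else if n = 2 then j else if n = 3 then k else l"
  have swap: "T (?f (\<sigma> 1)) (?f (\<sigma> 2)) (?f (\<sigma> 3)) (?f (\<sigma> 4)) = T (?f 1) (?f 2) (?f 3) (?f 4)"
    if "\<sigma> permutes {1..4}" for \<sigma>
    using assms[unfolded symmetric_tensor_def, rule_format, OF that, of ?f] .
  have "Transposition.transpose 1 2 permutes {1..4::nat}" "Transposition.transpose 2 3 permutes {1..4::nat}"
    "Transposition.transpose 3 4 permutes {1..4::nat}"
    by (auto intro!: permutes_swap_id)
  from this[THEN swap]
  show "T j i k l = T i j k l" and "T i k j l = T i j k l" and "T i j l k = T i j k l"
    by (simp_all add: Transposition.transpose_def)
qed

lemma tensor_form_cyclic_symmetric: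
  fixes T :: "3 tensor4"
  assumes "cyclic_symmetric T"
  defines "a \<equiv> T 1 1 1 2" and "b \<equiv> T 1 2 2 2" and "c \<equiv> T 1 1 2 2" and "d \<equiv> T 1 1 2 3"
    and "e \<equiv> T 1 1 1 1"
  shows "tensor_form T v =
    (let x = v $ 1; y = v $ 2; z = v $ 3 in
      e * (x^4 + y^4 + z^4)
      + 4 * a * (x^3 * y + y^3 * z + z^3 * x) + 4 * b * (x^3 * z + y^3 * x + z^3 * y)
      + 6 * c * (x^2 * y^2 + y^2 * z^2 + z^2 * x^2) + 12 * d * (x * y * z * (x + y + z)))"
proof -
  have sym: "symmetric_tensor T"
    using assms(1) by (simp add: cyclic_symmetric_def)
  note swaps = symmetric_tensor_swaps[OF sym]
  have entries: "T 1 1 1 1 = e" "T 2 2 2 2 = e" "T 3 3 3 3 = e"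
    "T 1 1 1 2 = a" "T 2 2 2 3 = a" "T 1 3 3 3 = a"
    "T 1 1 1 3 = b" "T 1 2 2 2 = b" "T 2 3 3 3 = b"
    "T 1 1 2 2 = c" "T 1 1 3 3 = c" "T 2 2 3 3 = c"
    "T 1 1 2 3 = d" "T 1 2 2 3 = d" "T 1 2 3 3 = d"
    using assms(1) unfolding cyclic_symmetric_def a_def b_def c_def d_def e_def by auto
  \<comment> \<open>Oriented left to right, adjacent swaps sort the indices of each of the 81 entries.\<close>
  have sorted: "T 2 1 i j = T 1 2 i j" "T 3 1 i j = T 1 3 i j" "T 3 2 i j = T 2 3 i j"
    "T i 2 1 j = T i 1 2 j" "T i 3 1 j = T i 1 3 j" "T i 3 2 j = T i 2 3 j"
    "T i j 2 1 = T i j 1 2" "T i j 3 1 = T i j 1 3" "T i j 3 2 = T i j 2 3" for i j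
    using swaps by metis+
  show ?thesis
    unfolding tensor_form_def sum_3 Let_def sorted entries by algebra
qed

text \<open>
  With A, B, C as above, the form is
  \[
    (A^2 + B^2 + C^2)/2 + 4a (xy A + yz B + zx C)
      + 7 ((xy - yz)^2 + (yz - zx)^2 + (zx - xy)^2)/2 .
  \]
  The first bracket in the proof is A + 4a (xy - m), where m is the mean of xy, yz, zx; the other
  two are its cyclic shifts. Half the sum of their squares gives the first two terms and uses up
  16/3 of the 7 copies in the third, so that (7 - 16/3)/2 = 5/6 of the squared differences
  remains. The proof has everything multiplied by 6.
\<close>

lemma quartic_nonneg_opposite_signs:
  fixes a x y z :: real
  assumes "a^2 = 1"
  shows "x^4 + y^4 + z^4
    + 4 * a * (x^3 * y + y^3 * z + z^3 * x) - 4 * a * (x^3 * z + y^3 * x + z^3 * y)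
    + 6 * (x^2 * y^2 + y^2 * z^2 + z^2 * x^2) - 7 * (x * y * z * (x + y + z)) \<ge> 0"
    (is "?f \<ge> 0")
proof -
  have "0 \<le> 3 * ((x^2 - y^2 + 4 / 3 * a * (2 * (x * y) - y * z - z * x))^2
         + (y^2 - z^2 + 4 / 3 * a * (2 * (y * z) - z * x - x * y))^2
         + (z^2 - x^2 + 4 / 3 * a * (2 * (z * x) - x * y - y * z))^2)
    + 5 * ((x * y - y * z)^2 + (y * z - z * x)^2 + (z * x - x * y)^2)"
    by (intro add_nonneg_nonneg mult_nonneg_nonneg) simp_all
  also have "\<dots> = 6 * ?f"
    using assms by algebra
  finally show ?thesis
    by (simp only: zero_le_mult_iff) simp
qed

theorem theorem4p3:
  fixes T :: "3 tensor4"
  assumes "cyclic_symmetric T"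
    and "\<bar>T 1 1 1 2\<bar> = 1" and "\<bar>T 1 2 2 2\<bar> = 1"
    and "T 1 1 2 2 = 1" and "T 1 1 1 1 = 1"
    and "T 1 1 2 3 = - 7 / 12"
  shows "positive_semidefinite T \<longleftrightarrow> T 1 1 1 2 * T 1 2 2 2 = - 1"
proof -
  let ?a = "T 1 1 1 2" and ?b = "T 1 2 2 2"
  have form: "tensor_form T v =
    (let x = v $ 1; y = v $ 2; z = v $ 3 in
      x^4 + y^4 + z^4
      + 4 * ?a * (x^3 * y + y^3 * z + z^3 * x) + 4 * ?b * (x^3 * z + y^3 * x + z^3 * y)
      + 6 * (x^2 * y^2 + y^2 * z^2 + z^2 * x^2) - 7 * (x * y * z * (x + y + z)))" for v
    using assms by (simp add: tensor_form_cyclic_symmetric Let_def)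
  consider "?a = 1" "?b = 1" | "?a = -1" "?b = -1" | "?b = - ?a" "?a^2 = 1"
    using assms(2,3) by (auto simp: abs_if split: if_splits)
  then show ?thesis
  proof cases
    case 1
    have "tensor_form T (vector [20, -10, -9]) < 0"
      unfolding form by (simp add: Let_def vector_3 1)
    then have "\<not> positive_semidefinite T"
      unfolding positive_semidefinite_def by (meson not_less)
    with 1 show ?thesis by simp
  next
    case 2
    have "tensor_form T (vector [1, 1, 1]) < 0"
      unfolding form by (simp add: Let_def vector_3 2)
    then have "\<not> positive_semidefinite T"
      unfolding positive_semidefinite_def by (meson not_less)
    with 2 show ?thesis by simp
  next
    case 3
    have "tensor_form T v \<ge> 0" for v
      using quartic_nonneg_opposite_signs[OF 3(2), of "v $ 1" "v $ 2" "v $ 3"]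
      unfolding form by (simp add: Let_def 3(1))
    then have "positive_semidefinite T"
      by (simp add: positive_semidefinite_def)
    with 3 show ?thesis by (simp add: power2_eq_square)
  qed
qed

end
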